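(* Let $\mathcal{R}=\{(r,t)\mid r>0,\ t\in\mathbb{R}\}$ be equipped with the Riemannian metric $ds_2^2=dr^2+\frac{1}{r^2}\,dt^2$. Then $(\mathcal{R},ds_2^2)$ is not geodesically complete.
   Context: A Riemannian manifold is geodesically complete if every geodesic extends to a geodesic defined on all of $\mathbb{R}$. *)

theory Defs
  imports "HOL-Analysis.Analysis"
begin

text \<open>Riemannian manifolds covered by a single chart: an open set \<open>U\<close> of coordinates, with the
  metric given there by its coefficient matrix \<open>g p $ i $ j\<close>.\<close>

definition partial_deriv :: "'n::finite \<Rightarrow> (real ^ 'n \<Rightarrow> real) \<Rightarrow> real ^ 'n \<Rightarrow> real" where
  "partial_deriv i f p = frechet_derivative f (at p) (axis i 1)"

primrec Ck_on :: "nat \<Rightarrow> (real ^ 'n::finite) set \<Rightarrow> (real ^ 'n \<Rightarrow> real) \<Rightarrow> bool" where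
  "Ck_on 0 U f \<longleftrightarrow> continuous_on U f"
| "Ck_on (Suc k) U f \<longleftrightarrow>
     (\<forall>p\<in>U. f differentiable (at p)) \<and> (\<forall>i. Ck_on k U (partial_deriv i f))"

definition smooth_on :: "(real ^ 'n::finite) set \<Rightarrow> (real ^ 'n \<Rightarrow> real) \<Rightarrow> bool" where
  "smooth_on U f \<longleftrightarrow> (\<forall>k. Ck_on k U f)"

definition riemannian_metric_on ::
    "(real ^ 'n::finite) set \<Rightarrow> (real ^ 'n \<Rightarrow> real ^ 'n ^ 'n) \<Rightarrow> bool" where
  "riemannian_metric_on U g \<longleftrightarrow>
     open U \<and> (\<forall>i j. smooth_on U (\<lambda>p. g p $ i $ j)) \<and>
     (\<forall>p\<in>U. transpose (g p) = g p \<and> (\<forall>v. v \<noteq> 0 \<longrightarrow> v \<bullet> (g p *v v) > 0))"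

text \<open>The Christoffel symbol $\Gamma^k_{ij}$ of the Levi-Civita connection.\<close>

definition christoffel ::
    "(real ^ 'n::finite \<Rightarrow> real ^ 'n ^ 'n) \<Rightarrow> 'n \<Rightarrow> 'n \<Rightarrow> 'n \<Rightarrow> real ^ 'n \<Rightarrow> real" where
  "christoffel g k i j p =
     (\<Sum>l\<in>UNIV. matrix_inv (g p) $ k $ l *
        (partial_deriv i (\<lambda>q. g q $ j $ l) p + partial_deriv j (\<lambda>q. g q $ i $ l) p
          - partial_deriv l (\<lambda>q. g q $ i $ j) p)) / 2"

text \<open>Here \<open>v\<close> is the velocity of \<open>c\<close>, and the second derivative condition is the geodesic equation
  $\ddot c^k = -\sum_{i,j} \Gamma^k_{ij}(c)\, \dot c^i \dot c^j$. When the coefficients of \<open>g\<close> are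
  smooth, such a twice differentiable \<open>c\<close> is automatically smooth.\<close>

definition geodesic_on ::
    "(real ^ 'n::finite) set \<Rightarrow> (real ^ 'n \<Rightarrow> real ^ 'n ^ 'n) \<Rightarrow> real set \<Rightarrow> (real \<Rightarrow> real ^ 'n) \<Rightarrow> bool"
  where
  "geodesic_on U g I c \<longleftrightarrow>
     open I \<and> is_interval I \<and> I \<noteq> {} \<and> c ` I \<subseteq> U \<and>
     (\<exists>v. \<forall>s\<in>I.
        (c has_vector_derivative v s) (at s) \<and>
        (v has_vector_derivative
           (\<chi> k. - (\<Sum>i\<in>UNIV. \<Sum>j\<in>UNIV. christoffel g k i j (c s) * v s $ i * v s $ j))) (at s))"

definition geodesically_complete ::
    "(real ^ 'n::finite) set \<Rightarrow> (real ^ 'n \<Rightarrow> real ^ 'n ^ 'n) \<Rightarrow> bool" where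
  "geodesically_complete U g \<longleftrightarrow>
     (\<forall>I c. geodesic_on U g I c \<longrightarrow>
        (\<exists>d. geodesic_on U g UNIV d \<and> (\<forall>s\<in>I. d s = c s)))"

text \<open>The coordinates are $(r, t) = (p_1, p_2)$.\<close>

definition half_plane :: "(real ^ 2) set" where
  "half_plane = {p. p $ 1 > 0}"

definition ds2 :: "real ^ 2 \<Rightarrow> real ^ 2 ^ 2" where
  "ds2 p = vector [vector [1, 0],
                   vector [0, 1 / (p $ 1)\<^sup>2]]"

lemma open_half_plane: "open half_plane"
  unfolding half_plane_def by (intro open_Collect_less continuous_intros)

lemma Ck_on_cong:
  assumes "open U" "\<And>p. p \<in> U \<Longrightarrow> f p = h p" "Ck_on k U f"
  shows "Ck_on k U h"
  using assms(2,3)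
proof (induction k arbitrary: f h)
  case 0
  then show ?case by (simp cong: continuous_on_cong)
next
  case (Suc k)
  have d: "(h has_derivative D) (at p) \<longleftrightarrow> (f has_derivative D) (at p)" if "p \<in> U" for p D
    using has_derivative_transform_within_open[OF _ \<open>open U\<close> that] Suc.prems(1) by metis
  have "f differentiable (at p)" if "p \<in> U" for p
    using Suc.prems(2) that by simp
  then have "h differentiable (at p)" if "p \<in> U" for p
    using d that unfolding differentiable_def by blast
  moreover have "partial_deriv i f p = partial_deriv i h p" if "p \<in> U" for i p
    unfolding partial_deriv_def frechet_derivative_def using d[OF that] by simp
  then have "Ck_on k U (partial_deriv i h)" for i
    using Suc.IH[of "partial_deriv i f" "partial_deriv i h"] Suc.prems(2) by simp
  ultimately show ?case by simp
qed

lemma smooth_on_inverse_power: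
  "smooth_on half_plane (\<lambda>p. a / (p $ 1) ^ n)"
proof -
  have "Ck_on k half_plane (\<lambda>p. a / (p $ 1) ^ n)" for k
  proof (induction k arbitrary: a n)
    case 0
    then show ?case
      by (auto simp: half_plane_def intro!: continuous_intros)
  next
    case (Suc k)
    have D: "((\<lambda>p. a / (p $ 1) ^ n) has_derivative
        (\<lambda>h. - (a * real n) / (p $ 1) ^ Suc n * h $ 1)) (at p)" if "p \<in> half_plane" for p :: "real ^ 2"
    proof -
      have r: "p $ 1 \<noteq> 0" using that by (simp add: half_plane_def)
      have c: "((\<lambda>p. p $ 1) has_derivative (\<lambda>h. h $ 1)) (at p)"
        by (intro bounded_linear_imp_has_derivative bounded_linear_vec_nth)
      have "((\<lambda>x. a / x ^ n) has_field_derivative - (a * real n) / (p $ 1) ^ Suc n) (at (p $ 1))"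
        by (rule DERIV_divide[OF DERIV_const DERIV_pow, THEN DERIV_cong])
          (use r in \<open>cases n; simp add: field_simps\<close>)+
      then show ?thesis
        using has_derivative_compose[OF c] unfolding has_field_derivative_def by blast
    qed
    have "(- (a * real n) * axis i (1::real) $ (1::2)) / (p $ 1) ^ Suc n
        = partial_deriv i (\<lambda>p. a / (p $ 1) ^ n) p" if "p \<in> half_plane" for i p
      unfolding partial_deriv_def frechet_derivative_at[OF D[OF that], symmetric] by simp
    then have "Ck_on k half_plane (partial_deriv i (\<lambda>p. a / (p $ 1) ^ n))" for i
      using Suc.IH[of "- (a * real n) * axis i (1::real) $ (1::2)" "Suc n"]
      by (rule Ck_on_cong[OF open_half_plane])
    then show ?case using differentiableI[OF D] by simp
  qed
  then show ?thesis by (simp add: smooth_on_def)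
qed

lemma riemannian_metric_on_ds2: "riemannian_metric_on half_plane ds2"
  unfolding riemannian_metric_on_def
proof (intro conjI allI ballI impI)
  show "open half_plane" by (rule open_half_plane)
next
  fix i j :: 2
  show "smooth_on half_plane (\<lambda>p. ds2 p $ i $ j)"
    using exhaust_2[of i] exhaust_2[of j] smooth_on_inverse_power[of 0 0]
      smooth_on_inverse_power[of 1 0] smooth_on_inverse_power[of 1 2]
    by (auto simp: ds2_def)
next
  fix p :: "real ^ 2"
  show "transpose (ds2 p) = ds2 p"
    by (simp add: vec_eq_iff transpose_def ds2_def forall_2)
next
  fix p v :: "real ^ 2"
  assume p: "p \<in> half_plane" and v: "v \<noteq> 0"
  have "v \<bullet> (ds2 p *v v) = (v $ 1)\<^sup>2 + (v $ 2 / p $ 1)\<^sup>2"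
    by (simp add: inner_vec_def matrix_vector_mult_def sum_2 ds2_def power2_eq_square)
  also have "\<dots> > 0"
    using p v by (auto simp: sum_power2_gt_zero_iff half_plane_def vec_eq_iff forall_2)
  finally show "v \<bullet> (ds2 p *v v) > 0" .
qed

end

theory Submission imports Defs begin

text \<open>The metric is singular along the edge \<open>r = 0\<close>, and this edge lies at finite distance. The ray
  \<open>s \<mapsto> (s, 0)\<close> runs into it: as the coefficients \<open>g\<^sub>1\<^sub>l\<close> of the metric are constant, the lines in
  the direction of \<open>r\<close> are geodesics of unit speed, so the ray, defined for \<open>s > 0\<close>, reaches the edge
  as \<open>s\<close> decreases to \<open>0\<close>. A geodesic on all of the real line that extends it would by continuity
  take a value with \<open>r = 0\<close> at the time \<open>0\<close>, and there is no such point in the half plane.\<close>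

lemma partial_deriv_const: "partial_deriv i (\<lambda>q. a) p = 0"
  by (simp add: partial_deriv_def)

text \<open>In \<open>\<Gamma>\<^sup>k\<^sub>i\<^sub>i\<close>, the entries of the inverse matrix are multiplied by derivatives of the
  coefficients \<open>g\<^sub>i\<^sub>l\<close> only, and these derivatives vanish.\<close>

lemma christoffel_eq_0_if_row_const:
  assumes "\<And>p l. g p $ i $ l = a l"
  shows "christoffel g k i i p = 0"
  by (simp add: christoffel_def assms partial_deriv_const)

lemma geodesic_on_coordinate_line:
  assumes row: "\<And>p l. g p $ i $ l = a l"
    and I: "open I" "is_interval I" "I \<noteq> {}"
    and U: "\<And>s. s \<in> I \<Longrightarrow> x + s *\<^sub>R axis i 1 \<in> U"
  shows "geodesic_on U g I (\<lambda>s. x + s *\<^sub>R axis i 1)"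
proof -
  \<comment> \<open>Only the component \<open>i\<close> of the velocity is nonzero, so that the acceleration prescribed by the
    geodesic equation reduces to \<open>- \<Gamma>\<^sup>k\<^sub>i\<^sub>i\<close>.\<close>
  have acc: "christoffel g k m j p * axis i 1 $ m * axis i 1 $ j = 0" for k m j p
    by (cases "m = i \<and> j = i") (auto simp: christoffel_eq_0_if_row_const[OF row] axis_def)
  have "((\<lambda>s. x + s *\<^sub>R axis i 1) has_vector_derivative axis i 1) (at s)" for s
    by (auto intro!: derivative_eq_intros)
  moreover have "((\<lambda>_. axis i 1) has_vector_derivative
      (\<chi> k. - (\<Sum>m\<in>UNIV. \<Sum>j\<in>UNIV.
        christoffel g k m j (x + s *\<^sub>R axis i 1) * axis i 1 $ m * axis i 1 $ j))) (at s)" for s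
    by (simp add: acc zero_vec_def[symmetric])
  ultimately show ?thesis
    unfolding geodesic_on_def using I U by (intro conjI exI[of _ "\<lambda>_. axis i 1"]) auto
qed

lemma geodesic_on_ds2_ray: "geodesic_on half_plane ds2 {0<..} (\<lambda>s. s *\<^sub>R axis 1 1)"
proof -
  have "ds2 p $ 1 $ l = axis 1 1 $ l" for p l
    using exhaust_2[of l] by (auto simp: ds2_def axis_def)
  then show ?thesis
    using geodesic_on_coordinate_line[where x = 0 and I = "{0<..}" and U = half_plane and g = ds2
        and i = 1 and a = "\<lambda>l. axis 1 1 $ l"]
    by (simp add: half_plane_def is_interval_oi)
qed

lemma geodesic_on_imp_isCont:
  assumes "geodesic_on U g I c" "s \<in> I"
  shows "isCont c s"
  using assms unfolding geodesic_on_def by (blast intro: has_vector_derivative_continuous)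

theorem corollary3p4: "\<not> geodesically_complete half_plane ds2"
proof
  assume "geodesically_complete half_plane ds2"
  then obtain d where d: "geodesic_on half_plane ds2 UNIV d"
    and eq: "\<And>s. s > 0 \<Longrightarrow> d s = s *\<^sub>R axis 1 1"
    using geodesic_on_ds2_ray unfolding geodesically_complete_def by fastforce
  have "(d \<longlongrightarrow> d 0) (at_right 0)"
    using geodesic_on_imp_isCont[OF d] by (simp add: isCont_def filterlim_at_split)
  then have "((\<lambda>s. d s $ 1) \<longlongrightarrow> d 0 $ 1) (at_right 0)"
    by (rule tendsto_vec_nth)
  moreover have "((\<lambda>s. d s $ 1) \<longlongrightarrow> 0) (at_right 0)"
  proof (rule Lim_transform_eventually)
    show "\<forall>\<^sub>F s in at_right 0. s = d s $ 1"
      by (rule eventually_at_rightI[of 0 1]) (auto simp: eq)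
  qed (rule tendsto_ident_at)
  ultimately have "d 0 $ 1 = 0"
    by (rule tendsto_unique[OF trivial_limit_at_right_real])
  moreover have "d 0 \<in> half_plane"
    using d by (auto simp: geodesic_on_def)
  ultimately show False
    by (simp add: half_plane_def)
qed

end
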